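(* Let $T:V\to\mathfrak g$ be a relative Rota-Baxter operator on an $n$-LieRep pair $(\mathfrak g,[-,\cdots,-]_{\mathfrak g};\rho)$. Then for a linear map $T':V\to\mathfrak g$, $T+T'$ is a relative Rota-Baxter operator (on the same $n$-LieRep pair) if and only if $T'$ is a Maurer-Cartan element of the twisted $L_\infty$-algebra $(C^*(V,\mathfrak g),l_1^T,\cdots,l_n^T)$, that is, $T'$ satisfies the Maurer-Cartan equation $$l_1^T(T')+\frac12l_2^T(T',T')+\frac1{3!}l_3^T(T',T',T')+\cdots+\frac1{n!}l_n^T(\underbrace{T',\cdots,T'}_n)=0.$$
   Context: All vector spaces are finite dimensional over an algebraically closed field $\mathbb K$ of characteristic $0$; $n\ge 2$ is an integer; a hat denotes omission. An $n$-Lie algebra is a vector space $\mathfrak g$ with a skew-symmetric linear map $\mu=[-,\cdots,-]_{\mathfrak g}:\wedge^n\mathfrak g\to\mathfrak g$ such that $[x_1,\cdots,x_{n-1},[y_1,\cdots,y_n]]=\sum_{i=1}^n[y_1,\cdots,y_{i-1},[x_1,\cdots,x_{n-1},y_i],y_{i+1},\cdots,y_n]$. A representation of it on $V$ is a linear map $\rho:\wedge^{n-1}\mathfrak g\to\mathfrak{gl}(V)$ with (1) $[\rho(\mathfrak X),\rho(\mathfrak Y)]=\rho(\mathfrak X\circ\mathfrak Y)$ (commutator on the left), where for $\mathfrak X=x_1\wedge\cdots\wedge x_{n-1}$, $\mathfrak Y=y_1\wedge\cdots\wedge y_{n-1}$, $\mathfrak X\circ\mathfrak Y=\sum_{i=1}^{n-1}y_1\wedge\cdots\wedge[x_1,\cdots,x_{n-1},y_i]_{\mathfrak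 g}\wedge\cdots\wedge y_{n-1}$; and (2) $\rho(x_1,\cdots,x_{n-2},[y_1,\cdots,y_n]_{\mathfrak g})=\sum_{i=1}^n(-1)^{n-i}\rho(y_1,\cdots,\widehat{y_i},\cdots,y_n)\rho(x_1,\cdots,x_{n-2},y_i)$. An $n$-LieRep pair $(\mathfrak g,[-,\cdots,-]_{\mathfrak g};\rho)$ is an $n$-Lie algebra together with a representation $\rho$ on a vector space $V$. A relative Rota-Baxter operator on the $n$-LieRep pair is a linear map $T:V\to\mathfrak g$ with $[Tv_1,\cdots,Tv_n]_{\mathfrak g}=\sum_{i=1}^n(-1)^{n-i}T(\rho(Tv_1,\cdots,\widehat{Tv_i},\cdots,Tv_n)(v_i))$ for all $v_i\in V$. For a vector space $W$, $\otimes^p(\wedge^{n-1}W)\wedge W$ means $W$ if $p=0$ and $\otimes^{p-1}(\wedge^{n-1}W)\otimes\wedge^nW$ if $p\ge1$; a map on it is written $P(\mathfrak X_1,\cdots,\mathfrak X_p,x)$ with $\mathfrak X_i\in\wedge^{n-1}W$, $x\in W$. Put $C^p(W,W)=\mathrm{Hom}(\otimes^p(\wedge^{n-1}W)\wedge W,W)$ (degree $p$). $\bigoplus_{p\ge0}C^p(W,W)$ is a graded Lie algebra under $[P,Q]_{n\text{-Lie}}=P\circ Q-(-1)^{pq}Q\circ P$ for $P\in C^p$, $Q\in C^q$, where, with $\mathfrak X_i=x_i^1\wedge\cdots\wedge x_i^{n-1}$, $$(P\circ Q)(\mathfrak X_1,\cdots,\mathfrak X_{p+q},x)=\sum_{k=1}^p(-1)^{(k-1)q}\sum_{\sigma\in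 S(k-1,q)}(-1)^\sigma\sum_{i=1}^{n-1}P(\mathfrak X_{\sigma(1)},\cdots,\mathfrak X_{\sigma(k-1)},x_{k+q}^1\wedge\cdots\wedge x_{k+q}^{i-1}\wedge Q(\mathfrak X_{\sigma(k)},\cdots,\mathfrak X_{\sigma(k+q-1)},x_{k+q}^i)\wedge x_{k+q}^{i+1}\wedge\cdots\wedge x_{k+q}^{n-1},\mathfrak X_{k+q+1},\cdots,\mathfrak X_{p+q},x)$$ $$+\sum_{\sigma\in S(p,q)}(-1)^{pq}(-1)^\sigma P(\mathfrak X_{\sigma(1)},\cdots,\mathfrak X_{\sigma(p)},Q(\mathfrak X_{\sigma(p+1)},\cdots,\mathfrak X_{\sigma(p+q)},x)),$$ and $S(i,j)$ is the set of $(i,j)$-shuffles. Let $C^m(V,\mathfrak g)=\mathrm{Hom}(\otimes^m(\wedge^{n-1}V)\wedge V,\mathfrak g)$ (degree $m$), $C^*(V,\mathfrak g)=\bigoplus_{m\ge0}C^m(V,\mathfrak g)$, viewed inside $\bigoplus_mC^m(W,W)$ with $W=\mathfrak g\oplus V$ by applying $P$ to the $V$-components of the arguments. Let $\mu+\rho\in C^1(W,W)$ be the map $(x_1+u_1,\cdots,x_n+u_n)\mapsto[x_1,\cdots,x_n]_{\mathfrak g}+\sum_{i=1}^n(-1)^{n-i}\rho(x_1,\cdots,\widehat{x_i},\cdots,x_n)(u_i)$. The $n$-ary bracket $\{P_1,\cdots,P_n\}=[\cdots[[\mu+\rho,P_1]_{n\text{-Lie}},P_2]_{n\text{-Lie}},\cdots,P_n]_{n\text{-Lie}}$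 makes $C^*(V,\mathfrak g)$ a Lie $n$-algebra (an $L_\infty$-algebra with only the $n$-ary bracket nonzero, with graded symmetric brackets of degree $1$) whose Maurer-Cartan elements (degree $0$ elements $\alpha$ with $\frac1{n!}\{\alpha,\cdots,\alpha\}=0$) are the relative Rota-Baxter operators. Twisting by the Maurer-Cartan element $T$ gives the $L_\infty$-algebra with brackets $$l_k^T(P_1,\cdots,P_k)=\frac1{(n-k)!}\{\underbrace{T,\cdots,T}_{n-k},P_1,\cdots,P_k\}\ (1\le k\le n),\qquad l_k^T=0\ (k\ge n+1).$$ A Maurer-Cartan element of an $L_\infty$-algebra $(L,\{l_k\})$ is a degree $0$ element $\alpha$ with $\sum_{k\ge1}\frac1{k!}l_k(\alpha,\cdots,\alpha)=0$. *)

theory Defs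
  imports
    "HOL-Analysis.Product_Vector"
    "HOL-Library.Function_Algebras"
    "HOL-Library.Groups_Big_Fun"
    "HOL-Combinatorics.Permutations"
    "HOL-Computational_Algebra.Polynomial"
begin

text \<open>Elements of \<open>Hom(\<And>\<^sup>k U, W)\<close> are represented by alternating multilinear maps, that is by
  functions on lists of vectors of which only the values on lists of length \<open>k\<close> matter.\<close>

definition alternating_map ::
  "('k::field \<Rightarrow> 'u::ab_group_add \<Rightarrow> 'u) \<Rightarrow> ('k \<Rightarrow> 'w::ab_group_add \<Rightarrow> 'w) \<Rightarrow> nat \<Rightarrow> ('u list \<Rightarrow> 'w) \<Rightarrow> bool"
  where "alternating_map s t k f \<longleftrightarrow>
    (\<forall>xs i. length xs = k \<and> i < k \<longrightarrow> Vector_Spaces.linear s t (\<lambda>x. f (xs[i := x]))) \<and>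
    (\<forall>xs. length xs = k \<and> \<not> distinct xs \<longrightarrow> f xs = 0)"

definition omit :: "nat \<Rightarrow> 'a list \<Rightarrow> 'a list"
  where "omit i xs = take i xs @ drop (Suc i) xs"

text \<open>Lists are indexed from \<open>0\<close>, so the sign \<open>(-1)\<^bsup>n-i\<^esup>\<close> attached to a position \<open>i \<in> {1..n}\<close>
  becomes \<open>(-1)\<^bsup>n-1-i\<^esup>\<close> with \<open>i < n\<close>.\<close>

locale n_Lie_algebra = vector_space scale
  for scale :: "'k::field \<Rightarrow> 'g::ab_group_add \<Rightarrow> 'g" +
  fixes n :: nat and bracket :: "'g list \<Rightarrow> 'g"
  assumes alternating_bracket: "alternating_map scale scale n bracket"
    and fundamental_identity: "\<lbrakk>length xs = n - 1; length ys = n\<rbrakk> \<Longrightarrow>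
      bracket (xs @ [bracket ys]) = (\<Sum>i<n. bracket (ys[i := bracket (xs @ [ys ! i])]))"

text \<open>A map from \<open>\<And>\<^bsup>n-1\<^esup> g\<close> to \<open>gl(V)\<close> is linear iff all its evaluations at vectors of \<open>V\<close> are.\<close>

locale n_LieRep_pair =
  n_Lie_algebra sg n bracket + V: vector_space sv
  for sg :: "'k::field \<Rightarrow> 'g::ab_group_add \<Rightarrow> 'g"
    and sv :: "'k \<Rightarrow> 'v::ab_group_add \<Rightarrow> 'v"
    and n :: nat and bracket :: "'g list \<Rightarrow> 'g" +
  fixes \<rho> :: "'g list \<Rightarrow> 'v \<Rightarrow> 'v"
  assumes linear_rho: "length X = n - 1 \<Longrightarrow> Vector_Spaces.linear sv sv (\<rho> X)"
    and alternating_rho: "alternating_map sg sv (n - 1) (\<lambda>X. \<rho> X v)"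
    and rho_commutator: "\<lbrakk>length X = n - 1; length Y = n - 1\<rbrakk> \<Longrightarrow>
      \<rho> X (\<rho> Y v) - \<rho> Y (\<rho> X v) = (\<Sum>i<n - 1. \<rho> (Y[i := bracket (X @ [Y ! i])]) v)"
    and rho_bracket: "\<lbrakk>length xs = n - 2; length ys = n\<rbrakk> \<Longrightarrow>
      \<rho> (xs @ [bracket ys]) v =
        (\<Sum>i<n. sv ((-1) ^ (n - 1 - i)) (\<rho> (omit i ys) (\<rho> (xs @ [ys ! i]) v)))"

definition relative_Rota_Baxter ::
  "('k::field \<Rightarrow> 'g::ab_group_add \<Rightarrow> 'g) \<Rightarrow> ('k \<Rightarrow> 'v::ab_group_add \<Rightarrow> 'v) \<Rightarrow> nat \<Rightarrow>
   ('g list \<Rightarrow> 'g) \<Rightarrow> ('g list \<Rightarrow> 'v \<Rightarrow> 'v) \<Rightarrow> ('v \<Rightarrow> 'g) \<Rightarrow> bool"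
  where "relative_Rota_Baxter sg sv n bracket \<rho> T \<longleftrightarrow>
    Vector_Spaces.linear sv sg T \<and>
    (\<forall>vs. length vs = n \<longrightarrow>
      bracket (map T vs) =
        (\<Sum>i<n. sg ((-1) ^ (n - 1 - i)) (T (\<rho> (map T (omit i vs)) (vs ! i)))))"

text \<open>A cochain takes a list \<open>[X\<^sub>1,\<dots>,X\<^sub>p]\<close> of blocks of \<open>n - 1\<close> vectors, standing for decomposable
  elements of \<open>\<And>\<^bsup>n-1\<^esup> U\<close>, and a vector. Homogeneous cochains of degree \<open>p\<close> are extended by \<open>0\<close> to
  lists of blocks of any other shape. Hence cochains of different degrees live in the same function
  space, and the direct sum of the spaces of homogeneous cochains is a subspace of it.\<close>

type_synonym ('u, 'w) cochain = "'u list list \<Rightarrow> 'u \<Rightarrow> 'w"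

definition cochains ::
  "nat \<Rightarrow> ('k::field \<Rightarrow> 'u::ab_group_add \<Rightarrow> 'u) \<Rightarrow> ('k \<Rightarrow> 'w::ab_group_add \<Rightarrow> 'w) \<Rightarrow> nat \<Rightarrow>
   ('u, 'w) cochain set"
  where "cochains n s t p = {P.
    (\<forall>Xs x. \<not> (length Xs = p \<and> (\<forall>X\<in>set Xs. length X = n - 1)) \<longrightarrow> P Xs x = 0) \<and>
    (if p = 0 then Vector_Spaces.linear s t (P [])
     else (\<forall>Xs x. length Xs = p \<and> (\<forall>X\<in>set Xs. length X = n - 1) \<longrightarrow>
        (\<forall>j<p - 1. alternating_map s t (n - 1) (\<lambda>X. P (Xs[j := X]) x)) \<and>
        alternating_map s t n (\<lambda>ys. P (Xs[p - 1 := butlast ys]) (last ys))))}"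

definition scale_cochain ::
  "('k \<Rightarrow> 'w \<Rightarrow> 'w) \<Rightarrow> 'k \<Rightarrow> ('u, 'w) cochain \<Rightarrow> ('u, 'w) cochain"
  where "scale_cochain s c P = (\<lambda>Xs x. s c (P Xs x))"

text \<open>\<open>(i,j)\<close>-shuffles, as permutations of \<open>{0..<i+j}\<close>.\<close>

definition shuffle_perms :: "nat \<Rightarrow> nat \<Rightarrow> (nat \<Rightarrow> nat) set"
  where "shuffle_perms i j =
    {\<sigma>. \<sigma> permutes {..<i + j} \<and> strict_mono_on {..<i} \<sigma> \<and> strict_mono_on {i..<i + j} \<sigma>}"

text \<open>\<open>P \<circ> Q\<close> for \<open>P\<close> of degree \<open>p\<close> and \<open>Q\<close> of degree \<open>q\<close>; the summation index \<open>k\<close> below is the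
  usual one (\<open>1 \<le> k \<le> p\<close>) minus one.\<close>

definition comp_cochain ::
  "nat \<Rightarrow> ('k::field \<Rightarrow> 'w::ab_group_add \<Rightarrow> 'w) \<Rightarrow> nat \<Rightarrow> nat \<Rightarrow>
   ('w, 'w) cochain \<Rightarrow> ('w, 'w) cochain \<Rightarrow> ('w, 'w) cochain"
  where "comp_cochain n s p q P Q = (\<lambda>Xs x.
    (\<Sum>k<p. s ((-1) ^ (k * q)) (\<Sum>\<sigma>\<in>shuffle_perms k q. s (of_int (sign \<sigma>)) (\<Sum>i<n - 1.
       P (map (\<lambda>j. Xs ! \<sigma> j) [0..<k]
          @ [(Xs ! (k + q))[i := Q (map (\<lambda>j. Xs ! \<sigma> j) [k..<k + q]) (Xs ! (k + q) ! i)]]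
          @ drop (Suc (k + q)) Xs) x)))
    + (\<Sum>\<sigma>\<in>shuffle_perms p q. s ((-1) ^ (p * q) * of_int (sign \<sigma>))
        (P (map (\<lambda>j. Xs ! \<sigma> j) [0..<p]) (Q (map (\<lambda>j. Xs ! \<sigma> j) [p..<p + q]) x))))"

text \<open>The bracket \<open>[P,Q] = P \<circ> Q - (-1)\<^bsup>pq\<^esup> Q \<circ> P\<close>, extended bilinearly to the direct sum: in degree
  \<open>m\<close> all splittings \<open>m = p + q\<close> are added up, and for homogeneous \<open>P\<close> and \<open>Q\<close> the only one that
  contributes is that given by their degrees.\<close>

definition nLie_bracket ::
  "nat \<Rightarrow> ('k::field \<Rightarrow> 'w::ab_group_add \<Rightarrow> 'w) \<Rightarrow>
   ('w, 'w) cochain \<Rightarrow> ('w, 'w) cochain \<Rightarrow> ('w, 'w) cochain"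
  where "nLie_bracket n s P Q = (\<lambda>Xs x. \<Sum>p\<le>length Xs. let q = length Xs - p in
    comp_cochain n s p q P Q Xs x - s ((-1) ^ (p * q)) (comp_cochain n s q p Q P Xs x))"

text \<open>The embedding of \<open>C\<^sup>*(V,g)\<close> into \<open>C\<^sup>*(W,W)\<close> with \<open>W = g \<times> V\<close>.\<close>

definition lift_cochain ::
  "('v, 'g) cochain \<Rightarrow> ('g \<times> 'v, 'g \<times> 'v::zero) cochain"
  where "lift_cochain P = (\<lambda>Xs w. (P (map (map snd) Xs) (snd w), 0))"

definition linear_cochain :: "('v \<Rightarrow> 'g::zero) \<Rightarrow> ('v, 'g) cochain"
  where "linear_cochain T = (\<lambda>Xs v. if Xs = [] then T v else 0)"

definition mu_plus_rho ::
  "nat \<Rightarrow> ('k::field \<Rightarrow> 'v::ab_group_add \<Rightarrow> 'v) \<Rightarrow> ('g::ab_group_add list \<Rightarrow> 'g) \<Rightarrow>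
   ('g list \<Rightarrow> 'v \<Rightarrow> 'v) \<Rightarrow> ('g \<times> 'v, 'g \<times> 'v) cochain"
  where "mu_plus_rho n sv bracket \<rho> = (\<lambda>Xs w.
    if length Xs = 1 \<and> length (hd Xs) = n - 1 then
      let ws = hd Xs @ [w] in
      (bracket (map fst ws),
       \<Sum>i<n. sv ((-1) ^ (n - 1 - i)) (\<rho> (map fst (omit i ws)) (snd (ws ! i))))
    else 0)"

definition nary_bracket ::
  "('k::field \<Rightarrow> 'g::ab_group_add \<Rightarrow> 'g) \<Rightarrow> ('k \<Rightarrow> 'v::ab_group_add \<Rightarrow> 'v) \<Rightarrow> nat \<Rightarrow>
   ('g list \<Rightarrow> 'g) \<Rightarrow> ('g list \<Rightarrow> 'v \<Rightarrow> 'v) \<Rightarrow>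
   ('g \<times> 'v, 'g \<times> 'v) cochain list \<Rightarrow> ('g \<times> 'v, 'g \<times> 'v) cochain"
  where "nary_bracket sg sv n bracket \<rho> Ps =
    foldl (nLie_bracket n (module_prod.scale sg sv)) (mu_plus_rho n sv bracket \<rho>) Ps"

text \<open>The brackets \<open>l\<^sub>k\<^sup>T\<close>; the \<open>k\<close>-th one takes lists of length \<open>k\<close>.\<close>

definition twisted_bracket ::
  "('k::field_char_0 \<Rightarrow> 'g::ab_group_add \<Rightarrow> 'g) \<Rightarrow> ('k \<Rightarrow> 'v::ab_group_add \<Rightarrow> 'v) \<Rightarrow> nat \<Rightarrow>
   ('g list \<Rightarrow> 'g) \<Rightarrow> ('g list \<Rightarrow> 'v \<Rightarrow> 'v) \<Rightarrow> ('v \<Rightarrow> 'g) \<Rightarrow> nat \<Rightarrow>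
   ('g \<times> 'v, 'g \<times> 'v) cochain list \<Rightarrow> ('g \<times> 'v, 'g \<times> 'v) cochain"
  where "twisted_bracket sg sv n bracket \<rho> T k Ps =
    (if 1 \<le> k \<and> k \<le> n then
       scale_cochain (module_prod.scale sg sv) (1 / fact (n - k))
         (nary_bracket sg sv n bracket \<rho>
           (replicate (n - k) (lift_cochain (linear_cochain T)) @ Ps))
     else 0)"

text \<open>Maurer-Cartan elements of a graded space \<open>(L\<^sub>m)\<close> with brackets \<open>l\<^sub>1, l\<^sub>2, \<dots>\<close>. The sum over all
  \<open>k \<ge> 1\<close> is required to have only finitely many nonzero terms, as \<^term>\<open>Sum_any\<close> returns \<open>0\<close>
  otherwise.\<close>

definition maurer_cartan ::
  "('k::field_char_0 \<Rightarrow> 'l::ab_group_add \<Rightarrow> 'l) \<Rightarrow> (nat \<Rightarrow> 'l set) \<Rightarrow> (nat \<Rightarrow> 'l list \<Rightarrow> 'l) \<Rightarrow>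
   'l \<Rightarrow> bool"
  where "maurer_cartan s L l \<alpha> \<longleftrightarrow>
    \<alpha> \<in> L 0 \<and>
    finite {k. k \<ge> 1 \<and> l k (replicate k \<alpha>) \<noteq> 0} \<and>
    Sum_any (\<lambda>k. if k \<ge> 1 then s (1 / fact k) (l k (replicate k \<alpha>)) else 0) = 0"

end

theory Submission
  imports Defs
begin

text \<open>On \<open>W = g \<times> V\<close> every linear \<open>T : V \<rightarrow> g\<close> gives the operator \<open>a(x, u) = (T u, 0)\<close>, and the
  product of two such operators is \<open>0\<close>. Bracketing a cochain of degree \<open>1\<close>, that is a function \<open>f\<close>
  of \<open>n\<close> vectors, with \<open>T\<close> amounts to applying the operator
  \<open>D\<^sub>a f (w\<^sub>1,\<dots>,w\<^sub>n) = (\<Sum>i. f (w\<^sub>1,\<dots>,a w\<^sub>i,\<dots>,w\<^sub>n)) - a (f (w\<^sub>1,\<dots>,w\<^sub>n))\<close>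
  (\<open>nLie_bracket_block_linear\<close>).

  Let \<open>a\<close>, \<open>b\<close> belong to \<open>T\<close>, \<open>T'\<close>, and let \<open>f = \<mu> + \<rho>\<close>. Since \<open>a b = b a\<close>, the operators \<open>D\<^sub>a\<close> and
  \<open>D\<^sub>b\<close> commute, and \<open>D\<^sub>a\<^sub>+\<^sub>b = D\<^sub>a + D\<^sub>b\<close> on additive functions. The left-hand side of the Maurer-Cartan
  equation is therefore a binomial expansion without its term for \<open>k = 0\<close>
  (\<open>sum_foldl_nLie_bracket\<close>):
  \<open>(\<Sum>k=1..n. 1/(k! (n-k)!) D\<^sub>b\<^sup>k D\<^sub>a\<^sup>n\<^sup>-\<^sup>k f) = 1/n! (D\<^sub>a\<^sub>+\<^sub>b\<^sup>n f - D\<^sub>a\<^sup>n f)\<close>.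

  As \<open>a\<^sup>2 = 0\<close>, only the terms of \<open>D\<^sub>a\<^sup>n f\<close> in which \<open>a\<close> hits every slot at most once and the value at
  most once survive, whence
  \<open>D\<^sub>a\<^sup>n f (w\<^sub>1,\<dots>,w\<^sub>n) = n! (f (a w\<^sub>1,\<dots>,a w\<^sub>n) - (\<Sum>i. a (f (a w\<^sub>1,\<dots>,w\<^sub>i,\<dots>,a w\<^sub>n))))\<close>
  (\<open>slot_derivation_funpow_length\<close>). For \<open>f = \<mu> + \<rho>\<close> this is \<open>n!\<close> times the difference of the two
  sides of the Rota-Baxter identity, so that \<open>D\<^sub>a\<^sup>n f = 0\<close> holds iff \<open>T\<close> is a relative Rota-Baxter
  operator (\<open>relative_Rota_Baxter_iff_slot_derivation\<close>). The same applied to \<open>T + T'\<close> gives the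
  theorem, because \<open>D\<^sub>a\<^sup>n f = 0\<close> for the given \<open>T\<close>.\<close>

section \<open>Derivations acting on the slots of a multi-additive function\<close>

text \<open>Functions of lists that are additive in each argument, whatever the length of the list. A
  function of exactly \<open>n\<close> arguments is made to fit by setting it to \<open>0\<close> on lists of other lengths.\<close>

definition slot_additive :: "('w::ab_group_add list \<Rightarrow> 'w) \<Rightarrow> bool"
  where "slot_additive f \<longleftrightarrow>
    (\<forall>ws i x y. i < length ws \<longrightarrow> f (ws[i := x + y]) = f (ws[i := x]) + f (ws[i := y]))"

text \<open>The natural action of an operator \<open>a\<close> on functions of lists, up to a global sign.\<close>

definition slot_derivation ::
  "('w::ab_group_add \<Rightarrow> 'w) \<Rightarrow> ('w list \<Rightarrow> 'w) \<Rightarrow> 'w list \<Rightarrow> 'w"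
  where "slot_derivation a f = (\<lambda>ws. (\<Sum>i<length ws. f (ws[i := a (ws ! i)])) - a (f ws))"

lemma slot_additiveD:
  "slot_additive f \<Longrightarrow> i < length ws \<Longrightarrow> f (ws[i := x + y]) = f (ws[i := x]) + f (ws[i := y])"
  by (simp add: slot_additive_def)

lemma slot_additive_zero:
  assumes "slot_additive f" "i < length ws"
  shows "f (ws[i := 0]) = 0"
  using slot_additiveD[OF assms, of 0 0] by simp

lemma slot_additive_zero_nth:
  assumes "slot_additive f" "i < length ws" "ws ! i = 0"
  shows "f ws = 0"
  using slot_additive_zero[OF assms(1,2)] assms(3) by (metis list_update_id)

lemma additive_sum:
  assumes "Modules.additive a"
  shows "a (sum g A) = (\<Sum>x\<in>A. a (g x))"
  by (rule Modules.additive.sum[OF assms])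

lemma slot_additive_slot_derivation:
  assumes f: "slot_additive f" and a: "Modules.additive a"
  shows "slot_additive (slot_derivation a f)"
  unfolding slot_additive_def
proof (intro allI impI)
  fix ws :: "'a list" and i x y
  assume i: "i < length ws"
  have "f (ws[i := x + y, j := a (ws[i := x + y] ! j)]) =
      f (ws[i := x, j := a (ws[i := x] ! j)]) + f (ws[i := y, j := a (ws[i := y] ! j)])"
    if "j < length ws" for j
  proof (cases "i = j")
    case True
    then show ?thesis
      using i slot_additiveD[OF f i] by (simp add: Modules.additive.add[OF a])
  next
    case False
    then show ?thesis
      using i slot_additiveD[OF f, of i "ws[j := a (ws ! j)]"] by (simp add: list_update_swap)
  qed
  then show "slot_derivation a f (ws[i := x + y]) =
      slot_derivation a f (ws[i := x]) + slot_derivation a f (ws[i := y])"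
    by (simp add: slot_derivation_def sum.distrib slot_additiveD[OF f i]
        Modules.additive.add[OF a])
qed

lemma slot_additive_slot_derivation_funpow:
  assumes "slot_additive f" "Modules.additive a"
  shows "slot_additive ((slot_derivation a ^^ m) f)"
  by (induction m) (simp_all add: assms slot_additive_slot_derivation)

lemma slot_derivation_commute:
  assumes a: "Modules.additive a" and b: "Modules.additive b" and ab: "\<And>w. a (b w) = b (a w)"
  shows "slot_derivation a (slot_derivation b f) = slot_derivation b (slot_derivation a f)"
proof
  fix ws :: "'a list"
  \<comment> \<open>For \<open>i = j\<close> the entry becomes \<open>b (a w)\<close> and \<open>a (b w)\<close>, respectively.\<close>
  have sw: "f (ws[i := a (ws ! i), j := b (ws[i := a (ws ! i)] ! j)]) =
      f (ws[j := b (ws ! j), i := a (ws[j := b (ws ! j)] ! i)])"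
    if "i < length ws" "j < length ws" for i j
    using that by (cases "i = j") (simp_all add: list_update_swap ab)
  have "(\<Sum>i<length ws. \<Sum>j<length ws. f (ws[i := a (ws ! i), j := b (ws[i := a (ws ! i)] ! j)])) =
      (\<Sum>i<length ws. \<Sum>j<length ws. f (ws[i := b (ws ! i), j := a (ws[i := b (ws ! i)] ! j)]))"
    by (subst sum.swap) (simp add: sw)
  then show "slot_derivation a (slot_derivation b f) ws =
      slot_derivation b (slot_derivation a f) ws"
    by (simp add: slot_derivation_def sum_subtractf Modules.additive.diff[OF a]
        Modules.additive.diff[OF b] additive_sum[OF a] additive_sum[OF b] ab)
qed

lemma slot_derivation_commute_funpow:
  assumes "Modules.additive a" "Modules.additive b" "\<And>w. a (b w) = b (a w)"
  shows "(slot_derivation a ^^ m) (slot_derivation b f) =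
    slot_derivation b ((slot_derivation a ^^ m) f)"
  by (induction m) (simp_all add: slot_derivation_commute[OF assms])

lemma slot_derivation_add_operator:
  assumes "slot_additive f"
  shows "slot_derivation (\<lambda>w. a w + b w) f =
    (\<lambda>ws. slot_derivation a f ws + slot_derivation b f ws)"
  by (rule ext) (simp add: slot_derivation_def slot_additiveD[OF assms] sum.distrib)

lemma slot_derivation_add:
  assumes "Modules.additive a"
  shows "slot_derivation a (\<lambda>ws. f ws + g ws) =
    (\<lambda>ws. slot_derivation a f ws + slot_derivation a g ws)"
  by (rule ext) (simp add: slot_derivation_def sum.distrib Modules.additive.add[OF assms])

lemma slot_derivation_funpow_add:
  assumes "Modules.additive a"
  shows "(slot_derivation a ^^ m) (\<lambda>ws. f ws + g ws) =
    (\<lambda>ws. (slot_derivation a ^^ m) f ws + (slot_derivation a ^^ m) g ws)"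
  by (induction m) (simp_all add: slot_derivation_add[OF assms])

section \<open>Powers of a derivation\<close>

lemma (in vector_space) slot_derivation_binomial:
  assumes a: "Modules.additive a" and b: "Modules.additive b" and ab: "\<And>w. a (b w) = b (a w)"
    and f: "slot_additive f"
  shows "(slot_derivation (\<lambda>w. a w + b w) ^^ m) f ws =
    (\<Sum>k\<le>m. scale (of_nat (m choose k))
      ((slot_derivation b ^^ k) ((slot_derivation a ^^ (m - k)) f) ws))"
  using f
proof (induction m arbitrary: f)
  case (Suc m)
  define F where "F k l = (slot_derivation b ^^ k) ((slot_derivation a ^^ l) f) ws" for k l
  have add: "Modules.additive (\<lambda>w. a w + b w)"
    by (simp add: Modules.additive_def Modules.additive.add[OF a] Modules.additive.add[OF b])
  have "(slot_derivation (\<lambda>w. a w + b w) ^^ Suc m) f ws =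
      (slot_derivation (\<lambda>w. a w + b w) ^^ m) (slot_derivation a f) ws +
      (slot_derivation (\<lambda>w. a w + b w) ^^ m) (slot_derivation b f) ws"
    unfolding funpow_Suc_right comp_def slot_derivation_add_operator[OF Suc.prems]
    by (simp add: slot_derivation_funpow_add[OF add])
  also have "\<dots> = (\<Sum>k\<le>m. scale (of_nat (m choose k)) (F k (Suc (m - k)))) +
      (\<Sum>k\<le>m. scale (of_nat (m choose k)) (F (Suc k) (m - k)))"
    by (simp add: Suc.IH slot_additive_slot_derivation Suc.prems a b F_def
        slot_derivation_commute_funpow[OF a b ab] funpow_swap1)
  also have "(\<Sum>k\<le>m. scale (of_nat (m choose k)) (F k (Suc (m - k)))) =
      (\<Sum>k\<le>Suc m. scale (of_nat (m choose k)) (F k (Suc m - k)))"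
    by (simp add: Suc_diff_le binomial_eq_0)
  also have "\<dots> = F 0 (Suc m) + (\<Sum>k\<le>m. scale (of_nat (m choose Suc k)) (F (Suc k) (m - k)))"
    by (subst sum.atMost_Suc_shift) (simp add: binomial_eq_0)
  also have "\<dots> + (\<Sum>k\<le>m. scale (of_nat (m choose k)) (F (Suc k) (m - k))) =
      (\<Sum>k\<le>Suc m. scale (of_nat (Suc m choose k)) (F k (Suc m - k)))"
    by (subst sum.atMost_Suc_shift) (simp add: sum.distrib scale_left_distrib algebra_simps)
  finally show ?case
    by (simp add: F_def)
qed simp

text \<open>The list obtained by applying \<open>a\<close> at the positions in \<open>S\<close>.\<close>

definition apply_on :: "('w \<Rightarrow> 'w) \<Rightarrow> nat set \<Rightarrow> 'w list \<Rightarrow> 'w list"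
  where "apply_on a S ws = map (\<lambda>i. if i \<in> S then a (ws ! i) else ws ! i) [0..<length ws]"

text \<open>The sum of the values of \<open>f\<close> over all ways to apply \<open>a\<close> at exactly \<open>k\<close> positions.\<close>

definition subset_sum ::
  "('w::ab_group_add \<Rightarrow> 'w) \<Rightarrow> nat \<Rightarrow> ('w list \<Rightarrow> 'w) \<Rightarrow> 'w list \<Rightarrow> 'w"
  where "subset_sum a k f = (\<lambda>ws. \<Sum>S | S \<subseteq> {..<length ws} \<and> card S = k. f (apply_on a S ws))"

lemma length_apply_on [simp]: "length (apply_on a S ws) = length ws"
  by (simp add: apply_on_def)

lemma nth_apply_on [simp]:
  "i < length ws \<Longrightarrow> apply_on a S ws ! i = (if i \<in> S then a (ws ! i) else ws ! i)"
  by (simp add: apply_on_def)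

lemma apply_on_update:
  assumes "i < length ws" "i \<notin> S"
  shows "apply_on a S (ws[i := a (ws ! i)]) = apply_on a (insert i S) ws"
  using assms by (intro nth_equalityI) (auto simp: nth_list_update)

lemma subset_sum_0: "subset_sum a 0 f = f"
proof
  fix ws :: "'a list"
  have "{S. S \<subseteq> {..<length ws} \<and> card S = 0} = {{}}"
    by (auto dest: finite_subset)
  moreover have "apply_on a {} ws = ws"
    by (intro nth_equalityI) auto
  ultimately show "subset_sum a 0 f ws = f ws"
    by (simp add: subset_sum_def)
qed

text \<open>Applying \<open>a\<close> at one more position \<open>i\<close> gives \<open>0\<close> if \<open>i\<close> was used before, as \<open>a\<^sup>2 = 0\<close>; and every
  set of \<open>k + 1\<close> positions arises in \<open>k + 1\<close> ways from a position and a set of \<open>k\<close> others.\<close>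

lemma (in vector_space) sum_subset_sum_update:
  assumes f: "slot_additive f" and a: "\<And>w. a (a w) = 0"
  shows "(\<Sum>i<length ws. subset_sum a k f (ws[i := a (ws ! i)])) =
    scale (of_nat (Suc k)) (subset_sum a (Suc k) f ws)"
proof -
  let ?N = "{..<length ws}"
  let ?A = "\<lambda>k. {S. S \<subseteq> ?N \<and> card S = k}"
  have fin [simp]: "finite (?A k)" for k by simp
  have finS: "finite S" if "S \<subseteq> ?N" for S using that finite_subset by blast
  have z: "f (apply_on a S (ws[i := a (ws ! i)])) =
      (if i \<in> S then 0 else f (apply_on a (insert i S) ws))" if "i \<in> ?N" for i S
    using that apply_on_update[of i ws S a]
    by (auto intro!: slot_additive_zero_nth[OF f, of i] simp: a)
  have "(\<Sum>i<length ws. subset_sum a k f (ws[i := a (ws ! i)])) =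
      (\<Sum>i\<in>?N. \<Sum>S\<in>?A k. if i \<in> S then 0 else f (apply_on a (insert i S) ws))"
    by (simp add: subset_sum_def z)
  also have "\<dots> = (\<Sum>i\<in>?N. \<Sum>S | S \<in> ?A k \<and> i \<notin> S. f (apply_on a (insert i S) ws))"
    by (intro sum.cong refl sum.mono_neutral_cong_right) (auto simp: finS)
  also have "\<dots> = (\<Sum>i\<in>?N. \<Sum>S | S \<in> ?A (Suc k) \<and> i \<in> S. f (apply_on a S ws))"
  proof (rule sum.cong[OF refl])
    fix i assume i: "i \<in> ?N"
    show "(\<Sum>S | S \<in> ?A k \<and> i \<notin> S. f (apply_on a (insert i S) ws)) =
        (\<Sum>S | S \<in> ?A (Suc k) \<and> i \<in> S. f (apply_on a S ws))"
      by (rule sum.reindex_bij_witness[of _ "\<lambda>S. S - {i}" "insert i"])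
        (use i in \<open>auto simp: insert_absorb dest: finS\<close>)
  qed
  also have "\<dots> = (\<Sum>S\<in>?A (Suc k). \<Sum>i | i \<in> ?N \<and> i \<in> S. f (apply_on a S ws))"
    by (rule sum.swap_restrict) auto
  also have "\<dots> = (\<Sum>S\<in>?A (Suc k). scale (of_nat (Suc k)) (f (apply_on a S ws)))"
  proof (rule sum.cong[OF refl])
    fix S assume "S \<in> ?A (Suc k)"
    then have "{i. i \<in> ?N \<and> i \<in> S} = S" "card S = Suc k" by auto
    then show "(\<Sum>i | i \<in> ?N \<and> i \<in> S. f (apply_on a S ws)) =
        scale (of_nat (Suc k)) (f (apply_on a S ws))"
      by (simp only: sum_constant_scale)
  qed
  finally show ?thesis
    by (simp add: subset_sum_def scale_sum_right)
qed

text \<open>Write \<open>S\<^sub>k\<close> for \<open>subset_sum a k f\<close>. A further application of the derivation turns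
  \<open>S\<^sub>k\<^sub>+\<^sub>1 - a S\<^sub>k\<close> into \<open>(k + 2) S\<^sub>k\<^sub>+\<^sub>2 - (k + 1) a S\<^sub>k\<^sub>+\<^sub>1 - a S\<^sub>k\<^sub>+\<^sub>1\<close>, as \<open>a (a S\<^sub>k) = 0\<close>.\<close>

lemma (in vector_space) slot_derivation_funpow_Suc:
  assumes f: "slot_additive f" and a: "Vector_Spaces.linear scale scale a" "\<And>w. a (a w) = 0"
  shows "(slot_derivation a ^^ Suc k) f ws =
    scale (of_nat (fact (Suc k))) (subset_sum a (Suc k) f ws - a (subset_sum a k f ws))"
proof -
  interpret a: Vector_Spaces.linear scale scale a by (rule a)
  note sums = sum_subset_sum_update[where a = a, OF f a(2)]
  show ?thesis
  proof (induction k arbitrary: ws)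
    case 0
    then show ?case
      using sums[of 0 ws] by (simp add: slot_derivation_def subset_sum_0)
  next
    case (Suc k)
    let ?S = "\<lambda>k. subset_sum a k f ws"
    have "(slot_derivation a ^^ Suc (Suc k)) f ws =
        (\<Sum>i<length ws. scale (of_nat (fact (Suc k)))
          (subset_sum a (Suc k) f (ws[i := a (ws ! i)]) - a (subset_sum a k f (ws[i := a (ws ! i)]))))
        - a (scale (of_nat (fact (Suc k))) (?S (Suc k) - a (?S k)))"
      by (subst funpow.simps, subst comp_apply, subst slot_derivation_def, subst (1 2) Suc.IH)
        (rule refl)
    also have "\<dots> = scale (of_nat (fact (Suc k)))
        (scale (of_nat (Suc (Suc k))) (?S (Suc (Suc k))) - a (scale (of_nat (Suc k)) (?S (Suc k)))
          - a (?S (Suc k)))"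
      by (simp only: scale_sum_right[symmetric] sum_subtractf a.sum[symmetric] sums
          a.scale a.diff a(2) diff_zero scale_zero_right scale_right_diff_distrib)
    also have "\<dots> = scale (of_nat (fact (Suc k)))
        (scale (of_nat (Suc (Suc k))) (?S (Suc (Suc k)) - a (?S (Suc k))))"
      proof -
      have "scale (of_nat (Suc (Suc k))) w = scale (of_nat (Suc k)) w + w" for w
        by (simp only: of_nat_Suc[of "Suc k"] scale_left_distrib scale_one add.commute)
      from this[of "a (?S (Suc k))"] show ?thesis
        by (simp only: a.scale scale_right_diff_distrib[of "of_nat (Suc (Suc k))"] diff_diff_eq)
    qed
    also have "\<dots> = scale (of_nat (fact (Suc (Suc k)))) (?S (Suc (Suc k)) - a (?S (Suc k)))"
      by (simp only: scale_scale fact_Suc[of "Suc k"] of_nat_mult of_nat_id mult.commute)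
    finally show ?case .
  qed
qed

lemma subset_sum_length: "subset_sum a (length ws) f ws = f (map a ws)"
proof -
  have "{S. S \<subseteq> {..<length ws} \<and> card S = length ws} = {{..<length ws}}"
    using card_subset_eq[of "{..<length ws}"] by auto
  moreover have "apply_on a {..<length ws} ws = map a ws"
    by (intro nth_equalityI) auto
  ultimately show ?thesis
    by (simp add: subset_sum_def)
qed

lemma subset_sum_length_minus_1:
  assumes "length ws = Suc k"
  shows "subset_sum a k f ws = (\<Sum>i<length ws. f ((map a ws)[i := ws ! i]))"
proof -
  let ?N = "{..<length ws}"
  have "bij_betw (\<lambda>i. ?N - {i}) ?N {S. S \<subseteq> ?N \<and> card S = k}"
    unfolding bij_betw_def
  proof (intro conjI set_eqI iffI)
    show "inj_on (\<lambda>i. ?N - {i}) ?N"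
      by (auto simp: inj_on_def)
  next
    fix S assume "S \<in> (\<lambda>i. ?N - {i}) ` ?N"
    then show "S \<in> {S. S \<subseteq> ?N \<and> card S = k}"
      using assms by auto
  next
    fix S assume "S \<in> {S. S \<subseteq> ?N \<and> card S = k}"
    then have S: "S \<subseteq> ?N" "card S = k" by auto
    then have "card (?N - S) = 1"
      using assms finite_subset[OF S(1)] by (simp add: card_Diff_subset)
    then obtain i where "?N - S = {i}"
      by (auto simp: card_1_singleton_iff)
    then have "i \<in> ?N" "S = ?N - {i}"
      using S by auto
    then show "S \<in> (\<lambda>i. ?N - {i}) ` ?N"
      by blast
  qed
  then have "subset_sum a k f ws = (\<Sum>i<length ws. f (apply_on a (?N - {i}) ws))"
    unfolding subset_sum_def by (rule sum.reindex_bij_betw[symmetric])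
  also have "\<dots> = (\<Sum>i<length ws. f ((map a ws)[i := ws ! i]))"
  proof (rule sum.cong[OF refl])
    fix i assume "i \<in> ?N"
    then have "apply_on a (?N - {i}) ws = (map a ws)[i := ws ! i]"
      by (intro nth_equalityI) (auto simp: nth_list_update)
    then show "f (apply_on a (?N - {i}) ws) = f ((map a ws)[i := ws ! i])"
      by simp
  qed
  finally show ?thesis .
qed

text \<open>The top power, where all slots but at most one have been hit.\<close>

lemma (in vector_space) slot_derivation_funpow_length:
  assumes "slot_additive f" "Vector_Spaces.linear scale scale a" "\<And>w. a (a w) = 0"
    and "length ws = n" "n \<ge> 1"
  shows "(slot_derivation a ^^ n) f ws =
    scale (of_nat (fact n)) (f (map a ws) - a (\<Sum>i<n. f ((map a ws)[i := ws ! i])))"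
proof -
  obtain k where k: "n = Suc k"
    using assms(5) by (cases n) auto
  show ?thesis
    unfolding k slot_derivation_funpow_Suc[OF assms(1-3)]
    using subset_sum_length[of a ws f] subset_sum_length_minus_1[of ws k a f] assms(4) k
    by simp
qed

section \<open>Brackets of a cochain of degree 1 with cochains of degree 0\<close>

text \<open>The cochain of degree \<open>1\<close> given by a function of \<open>n\<close> vectors, of which the first \<open>n - 1\<close> form
  the only block.\<close>

definition block_cochain :: "nat \<Rightarrow> ('u list \<Rightarrow> 'w::zero) \<Rightarrow> ('u, 'w) cochain"
  where "block_cochain n f = (\<lambda>Xs w.
    if length Xs = 1 \<and> length (hd Xs) = n - 1 then f (hd Xs @ [w]) else 0)"

lemma block_cochain_eq_0_iff:
  assumes "n \<ge> 1"
  shows "block_cochain n f = 0 \<longleftrightarrow> (\<forall>ws. length ws = n \<longrightarrow> f ws = 0)"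
proof
  assume *: "block_cochain n f = 0"
  show "\<forall>ws. length ws = n \<longrightarrow> f ws = 0"
  proof (intro allI impI)
    fix ws :: "'a list" assume "length ws = n"
    moreover from this have "ws \<noteq> []"
      using assms by auto
    ultimately have "block_cochain n f [butlast ws] (last ws) = f ws"
      by (simp add: block_cochain_def)
    with * show "f ws = 0" by simp
  qed
qed (use assms in \<open>auto simp: block_cochain_def fun_eq_iff\<close>)

lemma shuffle_perms_0_0: "shuffle_perms 0 0 = {id}"
  by (auto simp: shuffle_perms_def)

lemma shuffle_perms_1_0: "shuffle_perms (Suc 0) 0 = {id}"
  by (auto simp: shuffle_perms_def lessThan_Suc strict_mono_on_def)

lemma shuffle_perms_0_1: "shuffle_perms 0 (Suc 0) = {id}"
  by (auto simp: shuffle_perms_def lessThan_Suc strict_mono_on_def)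

text \<open>The bracket adds up all splittings \<open>p + q\<close> of the number of blocks, so the vanishing of the
  compositions for \<open>(p, q) \<noteq> (1, 0)\<close> has to be shown as well.\<close>

lemma (in vector_space) comp_cochain_block_linear:
  assumes f: "slot_additive f" and len: "length Xs = p + q" and n: "n \<ge> 1"
  shows "comp_cochain n scale p q (block_cochain n f) (linear_cochain a) Xs x =
    (if p = 1 \<and> q = 0 \<and> length (hd Xs) = n - 1
     then \<Sum>i<n. f ((hd Xs @ [x])[i := a ((hd Xs @ [x]) ! i)]) else 0)"
proof -
  obtain m where m: "n = Suc m"
    using n by (cases n) auto
  consider "p \<noteq> 1" | "p = 1" "q \<noteq> 0" | "p = 1" "q = 0" by blast
  then show ?thesis
  proof cases
    case 1
    have "block_cochain n f Ys y = 0" if "length Ys = p" for Ys and y :: 'b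
      using that 1 by (simp add: block_cochain_def)
    with 1 show ?thesis
      by (simp add: comp_cochain_def len)
  next
    case 2
    have "block_cochain n f [X[i := 0]] x = 0" if "i < n - 1" for X i
      using slot_additive_zero[OF f, of i "X @ [x]"] that
      by (auto simp: block_cochain_def list_update_append)
    moreover have "block_cochain n f [X] 0 = 0" for X
      using slot_additive_zero_nth[OF f, of "length X" "X @ [0]"] by (simp add: block_cochain_def)
    moreover have "linear_cochain a Ys y = 0" if "length Ys = q" for Ys :: "'b list list" and y
      using that 2 by (auto simp: linear_cochain_def)
    ultimately show ?thesis
      using 2 by (simp add: comp_cochain_def len)
  next
    case 3
    then obtain X where X: "Xs = [X]"
      using len by (auto simp: length_Suc_conv)
    have "(\<Sum>i<m. f (X[i := a (X ! i)] @ [x])) + f (X @ [a x]) =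
        (\<Sum>i<n. f ((X @ [x])[i := a ((X @ [x]) ! i)]))" if "length X = m"
      using that by (simp add: m list_update_append nth_append)
    then show ?thesis
      using 3 by (simp add: comp_cochain_def block_cochain_def linear_cochain_def X m
          shuffle_perms_0_0 shuffle_perms_1_0)
  qed
qed

lemma (in vector_space) comp_cochain_linear_block:
  assumes a: "a 0 = 0" and len: "length Xs = p + q"
  shows "comp_cochain n scale q p (linear_cochain a) (block_cochain n f) Xs x =
    (if p = 1 \<and> q = 0 \<and> length (hd Xs) = n - 1 then a (f (hd Xs @ [x])) else 0)"
proof -
  consider "q \<noteq> 0" | "q = 0" "p \<noteq> 1" | "q = 0" "p = 1" by blast
  then show ?thesis
  proof cases
    case 1
    then show ?thesis
      by (simp add: comp_cochain_def linear_cochain_def)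
  next
    case 2
    then show ?thesis
      by (simp add: comp_cochain_def linear_cochain_def block_cochain_def a)
  next
    case 3
    then obtain X where X: "Xs = [X]"
      using len by (auto simp: length_Suc_conv)
    show ?thesis
      using 3 by (simp add: comp_cochain_def block_cochain_def linear_cochain_def X
          shuffle_perms_0_1 a)
  qed
qed

lemma (in vector_space) nLie_bracket_block_linear:
  assumes f: "slot_additive f" and a: "Modules.additive a" and n: "n \<ge> 1"
  shows "nLie_bracket n scale (block_cochain n f) (linear_cochain a) =
    block_cochain n (slot_derivation a f)"
proof (intro ext)
  fix Xs :: "'b list list" and x :: 'b
  note a0 = Modules.additive.zero[OF a]
  have "nLie_bracket n scale (block_cochain n f) (linear_cochain a) Xs x =
    (\<Sum>p\<le>length Xs. if p = 1 \<and> length Xs = 1 \<and> length (hd Xs) = n - 1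
       then slot_derivation a f (hd Xs @ [x]) else 0)"
    unfolding nLie_bracket_def Let_def
  proof (rule sum.cong[OF refl])
    fix p assume "p \<in> {..length Xs}"
    then have len: "length Xs = p + (length Xs - p)" by simp
    show "comp_cochain n scale p (length Xs - p) (block_cochain n f) (linear_cochain a) Xs x
        - scale ((-1) ^ (p * (length Xs - p)))
          (comp_cochain n scale (length Xs - p) p (linear_cochain a) (block_cochain n f) Xs x) =
      (if p = 1 \<and> length Xs = 1 \<and> length (hd Xs) = n - 1
       then slot_derivation a f (hd Xs @ [x]) else 0)"
      unfolding comp_cochain_block_linear[OF f len n] comp_cochain_linear_block[where a = a, OF a0 len]
      using len n by (auto simp: slot_derivation_def)
  qed
  also have "\<dots> = block_cochain n (slot_derivation a f) Xs x"
    by (auto simp: block_cochain_def atMost_Suc)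
  finally show "nLie_bracket n scale (block_cochain n f) (linear_cochain a) Xs x =
    block_cochain n (slot_derivation a f) Xs x" .
qed

lemma (in vector_space) foldl_nLie_bracket_block_linear:
  assumes "slot_additive f" "Modules.additive a" "n \<ge> 1"
  shows "foldl (nLie_bracket n scale) (block_cochain n f) (replicate m (linear_cochain a)) =
    block_cochain n ((slot_derivation a ^^ m) f)"
  using assms(1)
proof (induction m arbitrary: f)
  case (Suc m)
  show ?case
    using Suc.IH[OF slot_additive_slot_derivation[OF Suc.prems assms(2)]]
    by (simp add: nLie_bracket_block_linear[OF Suc.prems assms(2,3)] funpow_swap1)
qed simp

lemma (in vector_space) scale_cochain_block_cochain:
  "scale_cochain scale c (block_cochain n f) = block_cochain n (\<lambda>ws. scale c (f ws))"
  by (auto simp: fun_eq_iff scale_cochain_def block_cochain_def)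

lemma sum_apply: "sum g A x = (\<Sum>k\<in>A. g k x)"
  by (induction A rule: infinite_finite_induct) auto

text \<open>The \<open>k\<close>-th summand is \<open>D\<^sub>b\<^sup>k D\<^sub>a\<^sup>m\<^sup>-\<^sup>k f / (k! (m - k)!)\<close>, so the binomial formula gives
  \<open>(D\<^sub>a\<^sub>+\<^sub>b\<^sup>m f - D\<^sub>a\<^sup>m f) / m!\<close>.\<close>

lemma sum_foldl_nLie_bracket:
  fixes s :: "'k::field_char_0 \<Rightarrow> 'w::ab_group_add \<Rightarrow> 'w"
  assumes s: "vector_space s"
    and a: "Modules.additive a" and b: "Modules.additive b" and ab: "\<And>w. a (b w) = b (a w)"
    and f: "slot_additive f" and n: "n \<ge> 1"
  shows "(\<Sum>k=1..m. scale_cochain s (1 / fact k) (scale_cochain s (1 / fact (m - k))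
      (foldl (nLie_bracket n s) (block_cochain n f)
        (replicate (m - k) (linear_cochain a) @ replicate k (linear_cochain b))))) =
    block_cochain n (\<lambda>ws. s (1 / fact m)
      ((slot_derivation (\<lambda>w. a w + b w) ^^ m) f ws - (slot_derivation a ^^ m) f ws))"
    (is "?lhs = _")
proof (intro ext)
  fix Xs :: "'w list list" and x :: 'w
  interpret vector_space s by (rule s)
  define F where "F k ws = (slot_derivation b ^^ k) ((slot_derivation a ^^ (m - k)) f) ws" for k ws
  have lhs: "?lhs = (\<Sum>k=1..m. block_cochain n (\<lambda>ws. s (1 / fact k) (s (1 / fact (m - k)) (F k ws))))"
    by (intro sum.cong refl)
      (simp add: foldl_nLie_bracket_block_linear[OF f a n]
        foldl_nLie_bracket_block_linear[OF slot_additive_slot_derivation_funpow[OF f a] b n]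
        scale_cochain_block_cochain F_def)
  have "?lhs Xs x =
      block_cochain n (\<lambda>ws. \<Sum>k=1..m. s (1 / fact k) (s (1 / fact (m - k)) (F k ws))) Xs x"
    unfolding lhs sum_apply by (auto simp: block_cochain_def)
  moreover have "(\<Sum>k=1..m. s (1 / fact k) (s (1 / fact (m - k)) (F k ws))) =
      s (1 / fact m) ((slot_derivation (\<lambda>w. a w + b w) ^^ m) f ws - (slot_derivation a ^^ m) f ws)"
    for ws
  proof -
    have "(\<Sum>k=1..m. s (1 / fact k) (s (1 / fact (m - k)) (F k ws))) =
        (\<Sum>k=1..m. s (1 / fact m) (s (of_nat (m choose k)) (F k ws)))"
      by (intro sum.cong refl) (simp add: binomial_fact field_simps)
    also have "\<dots> = s (1 / fact m) ((\<Sum>k\<le>m. s (of_nat (m choose k)) (F k ws)) - F 0 ws)"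
      by (simp add: scale_sum_right atMost_atLeast0 sum.atLeast_Suc_atMost)
    finally show ?thesis
      by (simp add: slot_derivation_binomial[OF a b ab f] F_def)
  qed
  ultimately show "?lhs Xs x = block_cochain n (\<lambda>ws. s (1 / fact m)
      ((slot_derivation (\<lambda>w. a w + b w) ^^ m) f ws - (slot_derivation a ^^ m) f ws)) Xs x"
    by simp
qed

section \<open>The operators and the structure map on the direct sum\<close>

text \<open>The operator \<open>(x, u) \<mapsto> (T u, 0)\<close> on \<open>g \<times> V\<close>.\<close>

definition lift_operator :: "('v \<Rightarrow> 'g) \<Rightarrow> 'g \<times> 'v \<Rightarrow> 'g \<times> 'v::zero"
  where "lift_operator T w = (T (snd w), 0)"

lemma lift_linear_cochain:
  "lift_cochain (linear_cochain T) = linear_cochain (lift_operator T)"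
  by (auto simp: lift_cochain_def linear_cochain_def lift_operator_def fun_eq_iff zero_prod_def)

lemma length_omit [simp]: "i < length xs \<Longrightarrow> length (omit i xs) = length xs - 1"
  by (simp add: omit_def)

lemma map_omit: "map f (omit i xs) = omit i (map f xs)"
  by (simp add: omit_def take_map drop_map)

lemma omit_update_same: "omit i (xs[i := x]) = omit i xs"
  by (simp add: omit_def)

lemma omit_update_less:
  "i < j \<Longrightarrow> j < length xs \<Longrightarrow> omit j (xs[i := x]) = (omit j xs)[i := x]"
  by (simp add: omit_def take_update_swap list_update_append)

lemma omit_update_greater:
  assumes "j < i" "i < length xs"
  shows "omit j (xs[i := x]) = (omit j xs)[i - 1 := x]"
proof -
  have "length (take j xs) = j" "\<not> i - 1 < j" using assms by simp_all
  then show ?thesis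
    using assms by (simp add: omit_def list_update_append drop_update_swap del: length_take)
qed

lemma alternating_map_additive:
  assumes "alternating_map s t k f" "length xs = k" "i < k"
  shows "f (xs[i := x + y]) = f (xs[i := x]) + f (xs[i := y])"
proof -
  interpret Vector_Spaces.linear s t "\<lambda>x. f (xs[i := x])"
    using assms by (simp add: alternating_map_def)
  show ?thesis by (rule add)
qed

context n_LieRep_pair
begin

text \<open>The map \<open>\<mu> + \<rho>\<close> as a function of \<open>n\<close> vectors of \<open>g \<times> V\<close>, that is the bracket of the
  semidirect product.\<close>

definition semidirect :: "('g \<times> 'v) list \<Rightarrow> 'g \<times> 'v"
  where "semidirect ws = (if length ws = n then (bracket (map fst ws),
    \<Sum>i<n. sv ((-1) ^ (n - 1 - i)) (\<rho> (map fst (omit i ws)) (snd (ws ! i)))) else 0)"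

lemma mu_plus_rho_eq:
  assumes "n \<ge> 1"
  shows "mu_plus_rho n sv bracket \<rho> = block_cochain n semidirect"
  using assms by (auto simp: fun_eq_iff mu_plus_rho_def block_cochain_def semidirect_def Let_def)

lemma rho_zero: "length X = n - 1 \<Longrightarrow> \<rho> X 0 = 0"
  by (rule module_hom.zero[OF linear_rho[unfolded Vector_Spaces.linear_iff_module_hom]])

lemma rho_add: "length X = n - 1 \<Longrightarrow> \<rho> X (u + v) = \<rho> X u + \<rho> X v"
  by (rule module_hom.add[OF linear_rho[unfolded Vector_Spaces.linear_iff_module_hom]])

lemma slot_additive_semidirect: "slot_additive semidirect"
  unfolding slot_additive_def
proof (intro allI impI)
  fix ws :: "('g \<times> 'v) list" and i x y
  assume i: "i < length ws"
  let ?r = "\<lambda>ws j. \<rho> (map fst (omit j ws)) (snd (ws ! j))"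
  show "semidirect (ws[i := x + y]) = semidirect (ws[i := x]) + semidirect (ws[i := y])"
  proof (cases "length ws = n")
    case True
    have "?r (ws[i := x + y]) j = ?r (ws[i := x]) j + ?r (ws[i := y]) j" if j: "j < n" for j
    proof -
      consider "j = i" | "i < j" | "j < i" by linarith
      then show ?thesis
      proof cases
        case 1
        then show ?thesis
          using True j by (simp add: omit_update_same rho_add)
      next
        case 2
        then show ?thesis
          using True j alternating_map_additive[OF alternating_rho, of "map fst (omit j ws)" i]
          by (simp add: omit_update_less map_update)
      next
        case 3
        then show ?thesis
          using True j i alternating_map_additive[OF alternating_rho, of "map fst (omit j ws)" "i - 1"]
          by (simp add: omit_update_greater map_update)
      qed
    qed
    then show ?thesis
      using True i alternating_map_additive[OF alternating_bracket, of "map fst ws" i]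
      by (simp add: semidirect_def map_update V.scale_right_distrib sum.distrib)
  qed (simp add: semidirect_def)
qed

lemma semidirect_map_lift_operator:
  assumes ws: "length ws = n"
  shows "semidirect (map (lift_operator T) ws) = (bracket (map T (map snd ws)), 0)"
proof -
  have "fst \<circ> lift_operator T = T \<circ> snd" by (auto simp: lift_operator_def)
  moreover have "\<rho> (map fst (omit i (map (lift_operator T) ws))) (snd (map (lift_operator T) ws ! i)) = 0"
    if "i < n" for i
    using that ws by (simp add: lift_operator_def rho_zero)
  ultimately show ?thesis
    using ws by (simp add: semidirect_def)
qed

text \<open>All entries but the \<open>i\<close>-th have second component \<open>0\<close>, hence only one summand of \<open>\<rho>\<close> remains.\<close>

lemma lift_operator_semidirect_update:
  assumes ws: "length ws = n" and T: "Vector_Spaces.linear sv sg T" and i: "i < n"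
  shows "lift_operator T (semidirect ((map (lift_operator T) ws)[i := ws ! i])) =
    (sg ((-1) ^ (n - 1 - i)) (T (\<rho> (map T (omit i (map snd ws))) (map snd ws ! i))), 0)"
proof -
  interpret T: Vector_Spaces.linear sv sg T by (rule T)
  let ?us = "(map (lift_operator T) ws)[i := ws ! i]"
  have "sv ((-1) ^ (n - 1 - j)) (\<rho> (map fst (omit j ?us)) (snd (?us ! j))) =
      (if j = i then sv ((-1) ^ (n - 1 - i)) (\<rho> (map T (omit i (map snd ws))) (snd (ws ! i))) else 0)"
    if j: "j < n" for j
  proof (cases "j = i")
    case True
    have "map fst (omit i ?us) = map T (omit i (map snd ws))"
      by (simp add: omit_update_same map_omit comp_def lift_operator_def)
    then show ?thesis
      using True ws i by simp
  next
    case False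
    then show ?thesis
      using ws j by (simp add: lift_operator_def rho_zero)
  qed
  then have "snd (semidirect ?us) =
      sv ((-1) ^ (n - 1 - i)) (\<rho> (map T (omit i (map snd ws))) (snd (ws ! i)))"
    using i ws by (simp add: semidirect_def)
  then show ?thesis
    using ws i by (simp add: lift_operator_def T.scale)
qed

lemma vector_space_prod_scale: "vector_space (module_prod.scale sg sv)"
proof -
  interpret vector_space_prod sg sv ..
  show ?thesis by (rule p.vector_space_axioms)
qed

lemma linear_lift_operator:
  assumes "Vector_Spaces.linear sv sg T"
  shows "Vector_Spaces.linear (module_prod.scale sg sv) (module_prod.scale sg sv) (lift_operator T)"
proof -
  interpret T: Vector_Spaces.linear sv sg T by (rule assms)
  interpret p: vector_space_prod sg sv ..
  show ?thesis
    by unfold_locales (auto simp: lift_operator_def p.scale_def T.add T.scale)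
qed

lemma lift_operator_lift_operator:
  assumes "Vector_Spaces.linear sv sg T"
  shows "lift_operator T (lift_operator T' w) = 0"
proof -
  interpret T: Vector_Spaces.linear sv sg T by (rule assms)
  show ?thesis by (simp add: lift_operator_def zero_prod_def T.zero)
qed

lemma additive_lift_operator:
  assumes "Vector_Spaces.linear sv sg T"
  shows "Modules.additive (lift_operator T)"
proof -
  interpret T: Vector_Spaces.linear sv sg T by (rule assms)
  show ?thesis
    by (auto simp: Modules.additive_def lift_operator_def T.add)
qed

section \<open>Relative Rota-Baxter operators\<close>

lemma relative_Rota_Baxter_iff_slot_derivation:
  assumes T: "Vector_Spaces.linear sv sg T" and n: "n \<ge> 1"
    and char: "of_nat (fact n) \<noteq> (0::'k)"
  shows "relative_Rota_Baxter sg sv n bracket \<rho> T \<longleftrightarrow>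
    (\<forall>ws. length ws = n \<longrightarrow> (slot_derivation (lift_operator T) ^^ n) semidirect ws = 0)"
proof -
  interpret W: vector_space "module_prod.scale sg sv" by (rule vector_space_prod_scale)
  let ?rhs = "\<lambda>vs. \<Sum>i<n. sg ((-1) ^ (n - 1 - i)) (T (\<rho> (map T (omit i vs)) (vs ! i)))"
  have eq: "(slot_derivation (lift_operator T) ^^ n) semidirect ws = 0 \<longleftrightarrow>
      bracket (map T (map snd ws)) = ?rhs (map snd ws)" if ws: "length ws = n" for ws
  proof -
    let ?S = "\<Sum>i<n. lift_operator T (semidirect ((map (lift_operator T) ws)[i := ws ! i]))"
    have "(slot_derivation (lift_operator T) ^^ n) semidirect ws =
        module_prod.scale sg sv (of_nat (fact n)) ((bracket (map T (map snd ws)), 0) - ?S)"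
      using W.slot_derivation_funpow_length[OF slot_additive_semidirect linear_lift_operator[OF T]
          lift_operator_lift_operator[OF T] ws n]
      by (simp add: semidirect_map_lift_operator[OF ws] additive_sum[OF additive_lift_operator[OF T]])
    also have "?S = (?rhs (map snd ws), 0)"
      by (simp add: lift_operator_semidirect_update[OF ws T] sum_prod)
    finally have "(slot_derivation (lift_operator T) ^^ n) semidirect ws = 0 \<longleftrightarrow>
        (bracket (map T (map snd ws)), 0) - (?rhs (map snd ws), 0) = (0 :: 'g \<times> 'v)"
      using char by (simp only: W.scale_eq_0_iff simp_thms)
    then show ?thesis
      by (simp add: prod_eq_iff)
  qed
  \<comment> \<open>The identity at \<open>ws\<close> involves only the \<open>V\<close>-components, and these are arbitrary.\<close>
  have "(\<forall>vs. length vs = n \<longrightarrow> bracket (map T vs) = ?rhs vs) \<longleftrightarrow>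
      (\<forall>ws::('g \<times> 'v) list. length ws = n \<longrightarrow>
        bracket (map T (map snd ws)) = ?rhs (map snd ws))"
  proof (intro iffI allI impI)
    fix vs :: "'v list"
    assume *: "\<forall>ws::('g \<times> 'v) list. length ws = n \<longrightarrow>
        bracket (map T (map snd ws)) = ?rhs (map snd ws)" and "length vs = n"
    then show "bracket (map T vs) = ?rhs vs"
      using *[rule_format, of "map (Pair 0) vs"] by (simp add: comp_def)
  qed (simp del: map_map)
  then show ?thesis
    using T by (auto simp: relative_Rota_Baxter_def eq)
qed

end

lemma linear_cochain_in_cochains:
  "Vector_Spaces.linear s t T \<Longrightarrow> linear_cochain T \<in> cochains n s t 0"
  by (auto simp: cochains_def linear_cochain_def)

theorem theorem3p12:
  fixes sg :: "'k::{alg_closed_field, field_char_0} \<Rightarrow> 'g::ab_group_add \<Rightarrow> 'g"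
    and sv :: "'k \<Rightarrow> 'v::ab_group_add \<Rightarrow> 'v"
    and Bg :: "'g set" and Bv :: "'v set"
    and n :: nat
    and bracket :: "'g list \<Rightarrow> 'g"
    and \<rho> :: "'g list \<Rightarrow> 'v \<Rightarrow> 'v"
    and T T' :: "'v \<Rightarrow> 'g"
  assumes "n \<ge> 2"
    and "finite_dimensional_vector_space sg Bg"
    and "finite_dimensional_vector_space sv Bv"
    and "n_LieRep_pair sg sv n bracket \<rho>"
    and "relative_Rota_Baxter sg sv n bracket \<rho> T"
    and "Vector_Spaces.linear sv sg T'"
  shows "(relative_Rota_Baxter sg sv n bracket \<rho> (\<lambda>v. T v + T' v) \<longleftrightarrow>
      maurer_cartan (scale_cochain (module_prod.scale sg sv))
        (\<lambda>m. lift_cochain ` cochains n sv sg m)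
        (twisted_bracket sg sv n bracket \<rho> T)
        (lift_cochain (linear_cochain T'))) \<and>
    (relative_Rota_Baxter sg sv n bracket \<rho> (\<lambda>v. T v + T' v) \<longleftrightarrow>
      (\<Sum>k=1..n. scale_cochain (module_prod.scale sg sv) (1 / fact k)
        (twisted_bracket sg sv n bracket \<rho> T k
          (replicate k (lift_cochain (linear_cochain T'))))) = 0)"
proof -
  interpret n_LieRep_pair sg sv n bracket \<rho> by (rule assms(4))
  interpret W: vector_space "module_prod.scale sg sv" by (rule vector_space_prod_scale)
  have n: "n \<ge> 1" using assms(1) by simp
  have T: "Vector_Spaces.linear sv sg T"
    using assms(5) by (simp add: relative_Rota_Baxter_def)
  note T' = assms(6)
  have TT': "Vector_Spaces.linear sv sg (\<lambda>v. T v + T' v)"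
    using T T' by (rule vector_space_pair.linear_compose_add[rotated]) unfold_locales
  have lift_operator_add: "lift_operator (\<lambda>v. T v + T' v) =
      (\<lambda>w. lift_operator T w + lift_operator T' w)"
    by (auto simp: lift_operator_def)
  have fact: "of_nat (fact n) \<noteq> (0::'k)" by simp
  let ?l = "twisted_bracket sg sv n bracket \<rho> T"
  let ?\<alpha> = "lift_cochain (linear_cochain T')"
  let ?s = "scale_cochain (module_prod.scale sg sv)"
  let ?sum = "\<Sum>k=1..n. ?s (1 / fact k) (?l k (replicate k ?\<alpha>))"
  have "?sum = (\<Sum>k=1..n. ?s (1 / fact k) (?s (1 / fact (n - k))
      (foldl (nLie_bracket n (module_prod.scale sg sv)) (block_cochain n semidirect)
        (replicate (n - k) (linear_cochain (lift_operator T)) @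
          replicate k (linear_cochain (lift_operator T'))))))"
    by (intro sum.cong refl)
      (simp add: twisted_bracket_def nary_bracket_def mu_plus_rho_eq[OF n] lift_linear_cochain)
  also have "\<dots> = block_cochain n (\<lambda>ws. module_prod.scale sg sv (1 / fact n)
      ((slot_derivation (lift_operator (\<lambda>v. T v + T' v)) ^^ n) semidirect ws
        - (slot_derivation (lift_operator T) ^^ n) semidirect ws))"
    unfolding lift_operator_add
    by (rule sum_foldl_nLie_bracket[OF vector_space_prod_scale additive_lift_operator[OF T]
        additive_lift_operator[OF T'] _ slot_additive_semidirect n])
      (simp add: lift_operator_lift_operator T T')
  finally have "?sum = 0 \<longleftrightarrow> (\<forall>ws. length ws = n \<longrightarrow>
      (slot_derivation (lift_operator (\<lambda>v. T v + T' v)) ^^ n) semidirect ws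
        = (slot_derivation (lift_operator T) ^^ n) semidirect ws)"
    by (simp add: block_cochain_eq_0_iff[OF n])
  also have "\<dots> \<longleftrightarrow> relative_Rota_Baxter sg sv n bracket \<rho> (\<lambda>v. T v + T' v)"
    using assms(5) relative_Rota_Baxter_iff_slot_derivation[OF T n fact]
      relative_Rota_Baxter_iff_slot_derivation[OF TT' n fact]
    by simp
  finally have main: "relative_Rota_Baxter sg sv n bracket \<rho> (\<lambda>v. T v + T' v) \<longleftrightarrow> ?sum = 0"
    by blast
  have fin: "finite {k. k \<ge> 1 \<and> ?l k (replicate k ?\<alpha>) \<noteq> 0}"
    by (rule finite_subset[of _ "{1..n}"]) (auto simp: twisted_bracket_def)
  have s0: "?s c 0 = 0" for c
    by (auto simp: scale_cochain_def fun_eq_iff)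
  let ?t = "\<lambda>k. if k \<ge> 1 then ?s (1 / fact k) (?l k (replicate k ?\<alpha>)) else 0"
  have "Sum_any ?t = sum ?t {1..n}"
    by (rule Sum_any.expand_superset) (auto simp: twisted_bracket_def s0 split: if_splits)
  then have "Sum_any ?t = ?sum"
    by simp
  moreover have "?\<alpha> \<in> lift_cochain ` cochains n sv sg 0"
    using linear_cochain_in_cochains[OF T'] by blast
  ultimately show ?thesis
    using main fin by (simp add: maurer_cartan_def)
qed

end
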